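(* Let $\mu,\nu\in\mathcal M$ with $\mu\leq_{pcd}\nu$. Then the shadow $S^\nu(\mu)$ of $\mu$ in $\nu$ is uniquely defined and given by $$P_{S^\nu(\mu)}=P_\nu-(P_\nu-P_\mu)^c .$$
   Context: $\mathcal M$ is the set of finite Borel measures $\eta$ on $\mathbb R$ with $\int|x|\,\eta(dx)<\infty$. For $\eta\in\mathcal M$, $P_\eta(k)=\int(k-x)^+\eta(dx)$, $k\in\mathbb R$; $P_\eta$ determines $\eta$, which is its second derivative in the sense of distributions. For $\eta,\chi\in\mathcal M$: $\eta\leq\chi$ means $\eta(A)\leq\chi(A)$ for all Borel $A$; $\eta\leq_{cd}\chi$ means $\int f\,d\eta\leq\int f\,d\chi$ for all convex non-increasing $f:\mathbb R\to\mathbb R$; $\eta\leq_{pcd}\chi$ means $\int f\,d\eta\leq\int f\,d\chi$ for all non-negative, convex, non-increasing $f$. For a function $f$, $f^c$ denotes its convex hull, the largest convex function lying below $f$. For $\mu\leq_{pcd}\nu$, the shadow $S^\nu(\mu)\in\mathcal M$ is the measure satisfying: (1) $\mu\leq_{cd}S^\nu(\mu)$; (2) $S^\nu(\mu)\leq\nu$; (3) if $\eta$ is another measure with $\mu\leq_{cd}\eta\leq\nu$, then $S^\nu(\mu)\leq_{cd}\eta$. *)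

theory Defs
  imports "HOL-Analysis.Analysis"
begin

definition fin_mean_measures :: "real measure set" where
  "fin_mean_measures =
     {\<eta>. sets \<eta> = sets borel \<and> finite_measure \<eta> \<and> integrable \<eta> (\<lambda>x. \<bar>x\<bar>)}"

definition put_fn :: "real measure \<Rightarrow> real \<Rightarrow> real" where
  "put_fn \<eta> k = (\<integral>x. max (k - x) 0 \<partial>\<eta>)"

(* The Bochner integral is 0 on non-integrable functions, but a convex non-increasing
   function may have integral +\<infinity>.  Its negative part is dominated by an affine function, so
   for a measure in fin_mean_measures the difference below is never \<infinity> - \<infinity>. *)
definition ext_integral :: "real measure \<Rightarrow> (real \<Rightarrow> real) \<Rightarrow> ereal" where
  "ext_integral \<eta> f =
     enn2ereal (\<integral>\<^sup>+x. ennreal (f x) \<partial>\<eta>) - enn2ereal (\<integral>\<^sup>+x. ennreal (- f x) \<partial>\<eta>)"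

definition cd_le :: "real measure \<Rightarrow> real measure \<Rightarrow> bool"  (infix "\<le>\<^sub>c\<^sub>d" 50) where
  "\<eta> \<le>\<^sub>c\<^sub>d \<theta> \<longleftrightarrow>
     (\<forall>f. convex_on UNIV f \<and> antimono f \<longrightarrow> ext_integral \<eta> f \<le> ext_integral \<theta> f)"

definition pcd_le :: "real measure \<Rightarrow> real measure \<Rightarrow> bool"  (infix "\<le>\<^sub>p\<^sub>c\<^sub>d" 50) where
  "\<eta> \<le>\<^sub>p\<^sub>c\<^sub>d \<theta> \<longleftrightarrow>
     (\<forall>f. (\<forall>x. 0 \<le> f x) \<and> convex_on UNIV f \<and> antimono f \<longrightarrow>
        ext_integral \<eta> f \<le> ext_integral \<theta> f)"

(* \<open>\<le>\<close> on functions is the pointwise order. *)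
definition convex_hull_fn :: "(real \<Rightarrow> real) \<Rightarrow> real \<Rightarrow> real" where
  "convex_hull_fn f = (GREATEST g. convex_on UNIV g \<and> g \<le> f)"

(* On measures with equal sigma-algebras, as here, the library order \<open>\<le>\<close> is setwise domination
   (le_measure). *)
definition is_shadow :: "real measure \<Rightarrow> real measure \<Rightarrow> real measure \<Rightarrow> bool" where
  "is_shadow \<nu> \<mu> S \<longleftrightarrow>
     S \<in> fin_mean_measures \<and> \<mu> \<le>\<^sub>c\<^sub>d S \<and> S \<le> \<nu> \<and>
     (\<forall>\<eta>\<in>fin_mean_measures. \<mu> \<le>\<^sub>c\<^sub>d \<eta> \<and> \<eta> \<le> \<nu> \<longrightarrow> S \<le>\<^sub>c\<^sub>d \<eta>)"

definition shadow :: "real measure \<Rightarrow> real measure \<Rightarrow> real measure" where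
  "shadow \<nu> \<mu> = (THE S. is_shadow \<nu> \<mu> S)"

end

theory Submission
  imports Defs "HOL-Probability.Distribution_Functions"
begin

text \<open>Write \<open>P\<^sub>\<eta>\<close> for the put function \<open>put_fn \<eta>\<close> and \<open>g\<close> for the convex hull of
  \<open>P\<^sub>\<nu> - P\<^sub>\<mu>\<close>. Everything is read off from put functions, because a finite measure
  with integrable put payoffs is determined by its put function (\<open>put_fn_inject\<close>), every convex
  function between \<open>0\<close> and a put function is again a put function (\<open>put_fn_surj\<close>), and both orders translate:
  for measures of equal mass, \<open>P\<^sub>\<eta> \<le> P\<^sub>\<chi>\<close> pointwise gives \<open>\<eta> \<le>\<^sub>c\<^sub>d \<chi>\<close> (\<open>cd_le_of_put_fn_le\<close>),
  while \<open>\<eta> \<le> \<chi>\<close> holds as soon as \<open>P\<^sub>\<chi> - P\<^sub>\<eta>\<close> is a put function (\<open>le_of_put_fn_add\<close>) and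
  makes this difference convex (\<open>convex_put_fn_diff\<close>).

  The heart of the matter is that \<open>P\<^sub>\<nu> - g\<close> is convex (\<open>convex_on_diff_convex_hull\<close>). Take a chord
  \<open>L\<close> of it over \<open>[x, y]\<close>. Replacing \<open>g\<close> on \<open>[x, y]\<close> by the maximum of \<open>g\<close> and \<open>P\<^sub>\<nu> - L\<close> gives a
  convex function that still lies below \<open>P\<^sub>\<nu> - P\<^sub>\<mu>\<close>, because the convex function \<open>P\<^sub>\<mu>\<close> is below
  \<open>L\<close> at both ends. As \<open>g\<close> is the largest such function, \<open>P\<^sub>\<nu> - L \<le> g\<close> on \<open>[x, y]\<close>, which says
  that \<open>P\<^sub>\<nu> - g\<close> stays below its chord.

  Hence \<open>P\<^sub>\<nu> - g\<close> and \<open>g\<close> are the put functions of measures \<open>S\<close> and \<open>T\<close>, and \<open>S + T = \<nu>\<close> gives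
  \<open>S \<le> \<nu>\<close>. A hinge \<open>a (k - K)\<^sup>+\<close> of slope \<open>a = \<nu>(\<real>) - \<mu>(\<real>)\<close> lies below \<open>P\<^sub>\<nu> - P\<^sub>\<mu>\<close>, so \<open>g\<close>
  has asymptotic slope \<open>a\<close> and \<open>S\<close> has the mass of \<open>\<mu>\<close>; with \<open>P\<^sub>\<mu> \<le> P\<^sub>S\<close> this yields
  \<open>\<mu> \<le>\<^sub>c\<^sub>d S\<close>. If \<open>\<mu> \<le>\<^sub>c\<^sub>d \<eta> \<le> \<nu>\<close>, then \<open>P\<^sub>\<nu> - P\<^sub>\<eta>\<close> is a convex minorant of \<open>P\<^sub>\<nu> - P\<^sub>\<mu>\<close>, so it
  lies below \<open>g\<close>; that is \<open>P\<^sub>S \<le> P\<^sub>\<eta>\<close>, and \<open>S\<close> is minimal. Two shadows dominate each other, so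
  their put functions agree and they are equal.\<close>

section \<open>Convex functions on the real line\<close>

lemma convex_on_below_line:
  fixes f :: "real \<Rightarrow> real"
  assumes f: "convex_on A f" and "x \<in> A" "y \<in> A" and z: "x \<le> z" "z \<le> y"
    and le: "f x \<le> \<alpha> * x + \<beta>" "f y \<le> \<alpha> * y + \<beta>"
  shows "f z \<le> \<alpha> * z + \<beta>"
proof (cases "x = y")
  case True
  then show ?thesis using z le by auto
next
  case False
  define t where "t = (z - x) / (y - x)"
  have t: "0 \<le> t" "t \<le> 1" using z False by (auto simp: t_def divide_simps)
  have "t * (y - x) = z - x" using False by (simp add: t_def)
  then have zt: "z = (1 - t) * x + t * y" by (simp add: algebra_simps)
  have "f z \<le> (1 - t) * f x + t * f y"
    using convex_onD[OF f t assms(2,3)] zt by simp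
  also have "\<dots> \<le> (1 - t) * (\<alpha> * x + \<beta>) + t * (\<alpha> * y + \<beta>)"
    using t le by (intro add_mono mult_left_mono) auto
  also have "\<dots> = \<alpha> * z + \<beta>" by (simp add: zt algebra_simps)
  finally show ?thesis .
qed

lemma convex_on_UNIV_lineI:
  fixes f :: "real \<Rightarrow> real"
  assumes *: "\<And>x y z \<alpha> \<beta>. x < z \<Longrightarrow> z < y \<Longrightarrow> f x = \<alpha> * x + \<beta> \<Longrightarrow> f y = \<alpha> * y + \<beta> \<Longrightarrow>
    f z \<le> \<alpha> * z + \<beta>"
  shows "convex_on UNIV f"
proof (rule convex_on_linorderI)
  fix t x y :: real assume t: "0 < t" "t < 1" and xy: "x < y"
  define z where "z = (1 - t) * x + t * y"
  define \<alpha> where "\<alpha> = (f y - f x) / (y - x)"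
  define \<beta> where "\<beta> = f x - \<alpha> * x"
  have zx: "z - x = t * (y - x)" and zy: "y - z = (1 - t) * (y - x)"
    by (simp_all add: z_def algebra_simps)
  have "x < z" "z < y" using zx zy t xy mult_pos_pos[of t "y - x"] mult_pos_pos[of "1 - t" "y - x"]
    by linarith+
  moreover have a: "\<alpha> * (y - x) = f y - f x" using xy by (simp add: \<alpha>_def)
  moreover have "f y = \<alpha> * y + \<beta>" using a by (simp add: \<beta>_def algebra_simps)
  ultimately have "f z \<le> \<alpha> * z + \<beta>" using *[of x z y \<alpha> \<beta>] by (simp add: \<beta>_def)
  also have "\<dots> = f x + \<alpha> * (z - x)" by (simp add: \<beta>_def algebra_simps)
  also have "\<dots> = f x + t * (\<alpha> * (y - x))" unfolding zx by simp
  also have "\<dots> = (1 - t) * f x + t * f y" unfolding a by (simp add: algebra_simps)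
  finally show "f ((1 - t) *\<^sub>R x + t *\<^sub>R y) \<le> (1 - t) * f x + t * f y"
    by (simp add: z_def)
qed simp

lemma convex_on_UNIV_max:
  fixes f g :: "real \<Rightarrow> real"
  assumes f: "convex_on UNIV f" and g: "convex_on UNIV g"
  shows "convex_on UNIV (\<lambda>x. max (f x) (g x))"
proof (rule convex_on_UNIV_lineI)
  fix x y z \<alpha> \<beta> :: real
  assume "x < z" "z < y"
    and ends: "max (f x) (g x) = \<alpha> * x + \<beta>" "max (f y) (g y) = \<alpha> * y + \<beta>"
  then have z: "x \<le> z" "z \<le> y" by simp_all
  have "f z \<le> \<alpha> * z + \<beta>"
    by (rule convex_on_below_line[OF f UNIV_I UNIV_I z]) (simp_all flip: ends)
  moreover have "g z \<le> \<alpha> * z + \<beta>"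
    by (rule convex_on_below_line[OF g UNIV_I UNIV_I z]) (simp_all flip: ends)
  ultimately show "max (f z) (g z) \<le> \<alpha> * z + \<beta>" by simp
qed

text \<open>Suppose the new graph is to be compared with its chord over \<open>[u, v]\<close> at a point where \<open>q\<close> is
  the larger function. If \<open>[u, v]\<close> sticks out of \<open>[x, y]\<close>, cut it off there: at the cut, \<open>q\<close> is
  below \<open>g\<close>, hence below the chord, and convexity of \<open>q\<close> on the remaining interval suffices.\<close>

lemma convex_on_UNIV_glue:
  fixes g q :: "real \<Rightarrow> real"
  assumes g: "convex_on UNIV g" and q: "convex_on {x..y} q"
    and ends: "q x \<le> g x" "q y \<le> g y"
  shows "convex_on UNIV (\<lambda>z. if z \<in> {x..y} then max (g z) (q z) else g z)"
proof (rule convex_on_UNIV_lineI)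
  define G where "G = (\<lambda>z. if z \<in> {x..y} then max (g z) (q z) else g z)"
  have gG: "g z \<le> G z" for z by (simp add: G_def)
  have qG: "q z \<le> G z" if "x \<le> z" "z \<le> y" for z using that by (simp add: G_def)
  fix u v w \<alpha> \<beta> :: real
  assume uwv: "u < w" "w < v"
  assume "(if u \<in> {x..y} then max (g u) (q u) else g u) = \<alpha> * u + \<beta>"
    and "(if v \<in> {x..y} then max (g v) (q v) else g v) = \<alpha> * v + \<beta>"
  then have G_ends: "G u = \<alpha> * u + \<beta>" "G v = \<alpha> * v + \<beta>" by (simp_all add: G_def)
  have g_ends: "g u \<le> \<alpha> * u + \<beta>" "g v \<le> \<alpha> * v + \<beta>"
    using gG[of u] gG[of v] unfolding G_ends .
  have g_line: "g z \<le> \<alpha> * z + \<beta>" if "u \<le> z" "z \<le> v" for z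
    by (rule convex_on_below_line[OF g UNIV_I UNIV_I that g_ends])
  have q_line: "q w \<le> \<alpha> * w + \<beta>" if w: "x \<le> w" "w \<le> y"
  proof -
    obtain u' where u': "x \<le> u'" "u' \<le> w" "q u' \<le> \<alpha> * u' + \<beta>"
    proof (cases "u < x")
      case True
      then show ?thesis using that[of x] g_line[of x] uwv w ends by linarith
    next
      case False
      then show ?thesis using that[of u] qG[of u] G_ends uwv w by linarith
    qed
    obtain v' where v': "w \<le> v'" "v' \<le> y" "q v' \<le> \<alpha> * v' + \<beta>"
    proof (cases "y < v")
      case True
      then show ?thesis using that[of y] g_line[of y] uwv w ends by linarith
    next
      case False
      then show ?thesis using that[of v] qG[of v] G_ends uwv w by linarith
    qed
    have "u' \<in> {x..y}" "v' \<in> {x..y}" using u' v' w by simp_all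
    from convex_on_below_line[OF q this u'(2) v'(1) u'(3) v'(3)] show ?thesis .
  qed
  have "G w \<le> \<alpha> * w + \<beta>"
    using g_line[of w] q_line uwv by (simp add: G_def)
  then show "(if w \<in> {x..y} then max (g w) (q w) else g w) \<le> \<alpha> * w + \<beta>"
    by (simp add: G_def)
qed

text \<open>The convex hull is a \<open>GREATEST\<close> description and carries information only once a greatest
  convex minorant is known to exist. It is the pointwise supremum of all convex minorants, and one
  minorant \<open>g0\<close> is enough for that supremum to be finite.\<close>

lemma convex_hull_fn_greatest:
  assumes "convex_on UNIV g0" "g0 \<le> f"
  shows "convex_on UNIV (convex_hull_fn f)" "convex_hull_fn f \<le> f"
    "\<And>g. convex_on UNIV g \<Longrightarrow> g \<le> f \<Longrightarrow> g \<le> convex_hull_fn f"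
proof -
  define C where "C = {g. convex_on UNIV g \<and> g \<le> f}"
  define s where "s x = (SUP g\<in>C. g x)" for x
  have ne: "C \<noteq> {}" using assms by (auto simp: C_def)
  have bdd: "bdd_above ((\<lambda>g. g x) ` C)" for x
    by (rule bdd_aboveI[of _ "f x"]) (auto simp: C_def le_fun_def)
  have upper: "g x \<le> s x" if "g \<in> C" for g x
    unfolding s_def by (rule cSUP_upper[OF that bdd])
  have "convex_on UNIV s"
  proof (rule convex_on_UNIV_lineI)
    fix x y z \<alpha> \<beta> :: real
    assume *: "x < z" "z < y" "s x = \<alpha> * x + \<beta>" "s y = \<alpha> * y + \<beta>"
    show "s z \<le> \<alpha> * z + \<beta>"
      unfolding s_def
    proof (rule cSUP_least[OF ne])
      fix g assume g: "g \<in> C"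
      then have "convex_on UNIV g" by (simp add: C_def)
      then show "g z \<le> \<alpha> * z + \<beta>"
        by (rule convex_on_below_line[of _ _ x y]) (use * upper[OF g, of x] upper[OF g, of y] in auto)
    qed
  qed
  moreover have "s \<le> f"
    unfolding s_def le_fun_def using ne by (auto intro!: cSUP_least simp: C_def le_fun_def)
  moreover have least: "g \<le> s" if "convex_on UNIV g" "g \<le> f" for g
    using upper[of g] that by (auto simp: C_def le_fun_def)
  ultimately have "convex_hull_fn f = s"
    unfolding convex_hull_fn_def by (intro Greatest_equality) auto
  then show "convex_on UNIV (convex_hull_fn f)" "convex_hull_fn f \<le> f"
    "\<And>g. convex_on UNIV g \<Longrightarrow> g \<le> f \<Longrightarrow> g \<le> convex_hull_fn f"
    using \<open>convex_on UNIV s\<close> \<open>s \<le> f\<close> least by auto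
qed

text \<open>The hull \<open>g\<close> can be raised to \<open>p - L\<close> over any interval on which \<open>L\<close> is the chord of \<open>p - g\<close>
  without leaving the convex minorants of \<open>p - q\<close>. Maximality of \<open>g\<close> turns this into the chord
  inequality for \<open>p - g\<close>.\<close>

lemma convex_on_diff_convex_hull:
  fixes p q :: "real \<Rightarrow> real"
  assumes p: "convex_on UNIV p" and q: "convex_on UNIV q"
    and minorant: "convex_on UNIV g0" "g0 \<le> (\<lambda>x. p x - q x)"
  shows "convex_on UNIV (\<lambda>x. p x - convex_hull_fn (\<lambda>x. p x - q x) x)"
proof (rule convex_on_UNIV_lineI)
  fix x y z \<alpha> \<beta> :: real
  define g where "g = convex_hull_fn (\<lambda>x. p x - q x)"
  note hull = convex_hull_fn_greatest[OF minorant, folded g_def]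
  assume xyz: "x < z" "z < y"
    and "p x - convex_hull_fn (\<lambda>x. p x - q x) x = \<alpha> * x + \<beta>"
    and "p y - convex_hull_fn (\<lambda>x. p x - q x) y = \<alpha> * y + \<beta>"
  then have ends: "p x - g x = \<alpha> * x + \<beta>" "p y - g y = \<alpha> * y + \<beta>" by (auto simp: g_def)
  have g_le: "g w \<le> p w - q w" for w using hull(2) by (auto simp: le_fun_def)
  let ?r = "\<lambda>w. p w - (\<alpha> * w + \<beta>)"
  let ?G = "\<lambda>w. if w \<in> {x..y} then max (g w) (?r w) else g w"
  have "convex_on UNIV (\<lambda>w. - \<alpha> * w - \<beta>)"
    by (rule convex_on_linorderI) (auto simp: algebra_simps)
  from convex_on_add[OF p this] have "convex_on UNIV ?r" by (simp add: algebra_simps)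
  then have "convex_on {x..y} ?r" by (rule convex_on_subset) auto
  then have "convex_on UNIV ?G"
    by (rule convex_on_UNIV_glue[OF hull(1)]) (use ends in auto)
  moreover have "q w \<le> \<alpha> * w + \<beta>" if "w \<in> {x..y}" for w
    by (rule convex_on_below_line[OF q, of x y])
      (use that ends g_le[of x] g_le[of y] in auto)
  then have "?r w \<le> p w - q w" if "w \<in> {x..y}" for w using that by fastforce
  then have "?G \<le> (\<lambda>w. p w - q w)"
    using g_le unfolding le_fun_def by simp
  ultimately have "?G \<le> g" by (rule hull(3))
  from le_funD[OF this, of z] have "?r z \<le> g z" using xyz by auto
  then show "p z - convex_hull_fn (\<lambda>x. p x - q x) z \<le> \<alpha> * z + \<beta>" by (simp add: g_def)
qed

text \<open>The right derivative of a convex function, as the infimum of its secant slopes to the right.\<close>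

definition right_slope :: "(real \<Rightarrow> real) \<Rightarrow> real \<Rightarrow> real" where
  "right_slope f x = (INF t\<in>{x<..}. (f x - f t) / (x - t))"

lemma right_slope_subgradient:
  assumes "convex_on UNIV f"
  shows "f x + right_slope f x * (y - x) \<le> f y"
  using convex_le_Inf_differential[OF assms, of x y] by (simp add: right_slope_def)

lemma right_slope_le_secant:
  assumes "convex_on UNIV f" "x < y"
  shows "right_slope f x \<le> (f y - f x) / (y - x)"
  using right_slope_subgradient[OF assms(1), of x y] assms(2)
  by (simp add: pos_le_divide_eq)

lemma right_slope_mono:
  assumes f: "convex_on UNIV f" and "x \<le> y"
  shows "right_slope f x \<le> right_slope f y"
proof (cases "x = y")
  case False
  have "(right_slope f x - right_slope f y) * (y - x) \<le> 0"
    using right_slope_subgradient[OF f, of x y] right_slope_subgradient[OF f, of y x]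
    by (simp add: algebra_simps)
  then show ?thesis using False \<open>x \<le> y\<close> by (simp add: mult_le_0_iff)
qed simp

lemma convex_on_UNIV_continuous:
  fixes f :: "real \<Rightarrow> real"
  shows "convex_on UNIV f \<Longrightarrow> continuous_on UNIV f"
  by (rule convex_on_continuous) auto

text \<open>A single secant from \<open>a\<close> with slope close to the infimum bounds the right slope at all
  nearby \<open>x > a\<close>, because the slope of the secant from \<open>x\<close> to the same endpoint varies continuously.\<close>

lemma right_slope_right_continuous:
  assumes f: "convex_on UNIV f"
  shows "continuous (at_right a) (right_slope f)"
  unfolding continuous_within
proof (rule order_tendstoI)
  fix c assume c: "c < right_slope f a"
  show "\<forall>\<^sub>F x in at_right a. c < right_slope f x"
    using c right_slope_mono[OF f, of a]
    by (auto simp: eventually_at_right_field intro!: exI[of _ "a + 1"] intro: less_le_trans)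
next
  fix c assume "right_slope f a < c"
  then obtain t where t: "a < t" "(f a - f t) / (a - t) < c"
    unfolding right_slope_def by (auto dest!: cInf_lessD[rotated])
  have "isCont f a"
    using convex_on_UNIV_continuous[OF f] by (simp add: continuous_on_eq_continuous_at)
  then have "(f \<longlongrightarrow> f a) (at_right a)"
    by (simp add: isCont_def filterlim_at_split)
  then have "((\<lambda>x. (f t - f x) / (t - x)) \<longlongrightarrow> (f t - f a) / (t - a)) (at_right a)"
    using t by (intro tendsto_intros) auto
  moreover have "(f t - f a) / (t - a) < c"
    using t by (metis minus_diff_eq minus_divide_divide)
  ultimately have "\<forall>\<^sub>F x in at_right a. (f t - f x) / (t - x) < c"
    by (rule order_tendstoD)
  moreover have "\<forall>\<^sub>F x in at_right a. x < t"
    using t by (auto simp: eventually_at_right_field)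
  ultimately show "\<forall>\<^sub>F x in at_right a. right_slope f x < c"
    by eventually_elim (use right_slope_le_secant[OF f] in force)
qed

section \<open>Put functions and distribution functions\<close>

text \<open>The difference of two put payoffs lies between multiples of indicators of half-lines. It is thus
  bounded, and its integral makes sense for every finite measure, even one whose put payoffs are not
  known to be integrable.\<close>

lemma put_difference_bounds:
  assumes M: "finite_borel_measure M" and uv: "u \<le> v"
  shows "integrable M (\<lambda>x. max (v - x) 0 - max (u - x) 0)"
    and "cdf M u * (v - u) \<le> (\<integral>x. max (v - x) 0 - max (u - x) 0 \<partial>M)"
    and "(\<integral>x. max (v - x) 0 - max (u - x) 0 \<partial>M) \<le> cdf M v * (v - u)"
proof -
  interpret finite_borel_measure M by fact
  note M_is_borel[measurable_cong]
  have ind: "integrable M (\<lambda>x. indicator {..w} x * (v - u))"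
    "(\<integral>x. indicator {..w} x * (v - u) \<partial>M) = cdf M w * (v - u)" for w
    by (simp_all add: cdf_def M_is_borel less_top[symmetric] borel_UNIV)
  show int: "integrable M (\<lambda>x. max (v - x) 0 - max (u - x) 0)"
    by (rule integrable_const_bound[where B = "v - u"]) (use uv in auto)
  show "cdf M u * (v - u) \<le> (\<integral>x. max (v - x) 0 - max (u - x) 0 \<partial>M)"
    unfolding ind(2)[symmetric]
    by (intro integral_mono ind int) (use uv in \<open>auto simp: indicator_def\<close>)
  show "(\<integral>x. max (v - x) 0 - max (u - x) 0 \<partial>M) \<le> cdf M v * (v - u)"
    unfolding ind(2)[symmetric]
    by (intro integral_mono ind int) (use uv in \<open>auto simp: indicator_def\<close>)
qed

text \<open>A measure constructed from a prospective put function is not known to have a finite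
  mean. Integrability of the put payoffs alone, which restricts only the tail at \<open>-\<infinity>\<close>, is what
  determining a measure by its put function takes.\<close>

definition put_integrable :: "real measure \<Rightarrow> bool" where
  "put_integrable M \<longleftrightarrow> finite_borel_measure M \<and> (\<forall>k. integrable M (\<lambda>x. max (k - x) 0))"

lemma put_fn_secant_bounds:
  assumes "put_integrable M" "u \<le> v"
  shows "cdf M u * (v - u) \<le> put_fn M v - put_fn M u"
    and "put_fn M v - put_fn M u \<le> cdf M v * (v - u)"
  using put_difference_bounds[of M u v] assms
  by (auto simp: put_integrable_def put_fn_def)

text \<open>If the secants of \<open>G\<close> and \<open>H\<close> have slopes between the values of \<open>F\<close> at their endpoints, then the
  increments of \<open>G - H\<close> over the cells of an equidistant partition of \<open>[u, v]\<close> are at most the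
  increments of \<open>F\<close> times the mesh. These telescope to \<open>(F v - F u) (v - u) / n\<close>, which vanishes in
  the limit. This replaces the fundamental theorem of calculus for convex functions.\<close>

lemma secant_bounds_increment_unique:
  fixes F G H :: "real \<Rightarrow> real"
  assumes G: "\<And>u v. u \<le> v \<Longrightarrow> F u * (v - u) \<le> G v - G u"
      "\<And>u v. u \<le> v \<Longrightarrow> G v - G u \<le> F v * (v - u)"
    and H: "\<And>u v. u \<le> v \<Longrightarrow> F u * (v - u) \<le> H v - H u"
      "\<And>u v. u \<le> v \<Longrightarrow> H v - H u \<le> F v * (v - u)"
    and uv: "u \<le> v"
  shows "G v - G u = H v - H u"
proof -
  define E where "E x = G x - H x" for x
  have E: "\<bar>E b - E a\<bar> \<le> (F b - F a) * (b - a)" if "a \<le> b" for a b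
    using G[OF that] H[OF that] by (auto simp: E_def algebra_simps)
  have bound: "\<bar>E v - E u\<bar> \<le> (F v - F u) * (v - u) / real (Suc n)" for n
  proof -
    define d where "d = (v - u) / real (Suc n)"
    define y where "y i = u + real i * d" for i
    have d: "0 \<le> d" using uv by (simp add: d_def)
    have y_ends: "y 0 = u" "y (Suc n) = v" by (simp_all add: y_def d_def del: of_nat_Suc)
    have step: "y (Suc i) - y i = d" for i by (simp add: y_def algebra_simps)
    have "\<bar>E v - E u\<bar> = \<bar>\<Sum>i<Suc n. E (y (Suc i)) - E (y i)\<bar>"
      by (simp only: sum_lessThan_telescope[of "\<lambda>i. E (y i)"] y_ends)
    also have "\<dots> \<le> (\<Sum>i<Suc n. \<bar>E (y (Suc i)) - E (y i)\<bar>)" by (rule sum_abs)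
    also have "\<dots> \<le> (\<Sum>i<Suc n. (F (y (Suc i)) - F (y i)) * d)"
    proof (rule sum_mono)
      fix i
      have "y i \<le> y (Suc i)" using step[of i] d by linarith
      from E[OF this] show "\<bar>E (y (Suc i)) - E (y i)\<bar> \<le> (F (y (Suc i)) - F (y i)) * d"
        by (simp only: step)
    qed
    also have "\<dots> = (F v - F u) * d"
      by (simp only: sum_distrib_right[symmetric] sum_lessThan_telescope[of "\<lambda>i. F (y i)"] y_ends)
    finally show ?thesis by (simp add: d_def)
  qed
  have "(\<lambda>n. (F v - F u) * (v - u) / real (Suc n)) \<longlonglongrightarrow> 0"
    by (rule LIMSEQ_Suc) (rule lim_const_over_n)
  then have "\<bar>E v - E u\<bar> \<le> 0"
    by (rule LIMSEQ_le_const) (use bound in blast)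
  then show ?thesis by (simp add: E_def)
qed

text \<open>Conversely, the secant bounds determine \<open>F\<close> up to its choice at jumps, which right-continuity
  fixes: \<open>F a \<le> F' v\<close> for all \<open>v > a\<close>, then let \<open>v\<close> decrease to \<open>a\<close>.\<close>

lemma right_continuous_secant_bounds_unique:
  fixes F F' P :: "real \<Rightarrow> real"
  assumes F: "\<And>u v. u < v \<Longrightarrow> F u * (v - u) \<le> P v - P u"
      "\<And>u v. u < v \<Longrightarrow> P v - P u \<le> F v * (v - u)"
    and F': "\<And>u v. u < v \<Longrightarrow> F' u * (v - u) \<le> P v - P u"
      "\<And>u v. u < v \<Longrightarrow> P v - P u \<le> F' v * (v - u)"
    and cont: "\<And>a. continuous (at_right a) F" "\<And>a. continuous (at_right a) F'"
  shows "F = F'"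
proof -
  have le: "A a \<le> B a"
    if A: "\<And>u v. u < v \<Longrightarrow> A u * (v - u) \<le> P v - P u"
      and B: "\<And>u v. u < v \<Longrightarrow> P v - P u \<le> B v * (v - u)"
      and "continuous (at_right a) B" for A B :: "real \<Rightarrow> real" and a
  proof (rule tendsto_lowerbound)
    show "(B \<longlongrightarrow> B a) (at_right a)" using that(3) by (simp add: continuous_within)
    have "A a \<le> B v" if "a < v" for v
    proof -
      have "A a * (v - a) \<le> B v * (v - a)" using A[OF that] B[OF that] by linarith
      then show ?thesis using that by simp
    qed
    then show "\<forall>\<^sub>F v in at_right a. A a \<le> B v"
      by (auto simp: eventually_at_right_field intro!: exI[of _ "a + 1"])
  qed simp
  show ?thesis
  proof (intro ext antisym)
    show "F x \<le> F' x" for x by (rule le[OF F(1) F'(2) cont(2)])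
    show "F' x \<le> F x" for x by (rule le[OF F'(1) F(2) cont(1)])
  qed
qed

lemma put_fn_inject:
  assumes M: "put_integrable M" and N: "put_integrable N" and eq: "put_fn M = put_fn N"
  shows "M = N"
proof (rule cdf_unique')
  show "cdf M = cdf N"
    by (rule right_continuous_secant_bounds_unique[where P = "put_fn M"])
      (use put_fn_secant_bounds[OF M] put_fn_secant_bounds[OF N] M N
        in \<open>auto simp: eq put_integrable_def finite_borel_measure.cdf_is_right_cont\<close>)
qed (use M N in \<open>auto simp: put_integrable_def\<close>)

lemma put_fn_at_bot:
  assumes M: "put_integrable M"
  shows "(put_fn M \<longlongrightarrow> 0) at_bot"
proof -
  interpret finite_borel_measure M using M by (simp add: put_integrable_def)
  note M_is_borel[measurable_cong]
  have "((\<lambda>k. \<integral>x. max (- k - x) 0 \<partial>M) \<longlongrightarrow> (\<integral>x. 0 \<partial>M)) at_top"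
  proof (rule integral_dominated_convergence_at_top)
    show "integrable M (\<lambda>x. max (0 - x) 0)" using M unfolding put_integrable_def by blast
    show "\<forall>\<^sub>F k in at_top. AE x in M. norm (max (- k - x) 0) \<le> max (0 - x) 0"
      using eventually_ge_at_top[of 0] by eventually_elim auto
    have "((\<lambda>k. max (- k - x) 0) \<longlongrightarrow> 0) at_top" for x :: real
      by (rule tendsto_eventually)
        (use eventually_ge_at_top[of "- x"] in \<open>eventually_elim, auto\<close>)
    then show "AE x in M. ((\<lambda>k. max (- k - x) 0) \<longlongrightarrow> 0) at_top" by simp
  qed auto
  then show ?thesis
    unfolding filterlim_at_bot_mirror put_fn_def by simp
qed

lemma put_fn_nonneg: "0 \<le> put_fn M k"
  unfolding put_fn_def by (rule integral_nonneg_AE) simp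

text \<open>The measure is the Stieltjes measure of the right derivative \<open>F\<close> of \<open>h\<close>. That \<open>F\<close> is a
  distribution function of a finite measure comes from the sandwich \<open>0 \<le> h \<le> P\<^sub>M\<close>: the upper bound
  forces \<open>h\<close> to vanish at \<open>-\<infinity>\<close> and limits its slope by the mass of \<open>M\<close>. The put function of the
  new measure and \<open>h\<close> both have secant slopes squeezed by \<open>F\<close>, hence equal increments, and both
  vanish at \<open>-\<infinity>\<close>.\<close>

lemma put_fn_surj:
  assumes M: "put_integrable M" and h: "convex_on UNIV h"
    and nonneg: "\<And>k. 0 \<le> h k" and le: "\<And>k. h k \<le> put_fn M k"
  obtains S where "put_integrable S" "put_fn S = h"
proof -
  interpret M: finite_borel_measure M using M by (simp add: put_integrable_def)
  define F where "F = right_slope h"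
  have F_mono: "F x \<le> F y" if "x \<le> y" for x y
    using right_slope_mono[OF h that] by (simp add: F_def)
  have tangent: "h x + F x * (y - x) \<le> h y" for x y
    using right_slope_subgradient[OF h] by (simp add: F_def)
  have h_bot: "(h \<longlongrightarrow> 0) at_bot"
    by (rule tendsto_sandwich[OF _ _ tendsto_const put_fn_at_bot[OF M]])
      (simp_all add: nonneg le)
  have F_nonneg: "0 \<le> F x" for x
  proof (rule ccontr)
    assume neg: "\<not> 0 \<le> F x"
    have "\<forall>\<^sub>F y in at_bot. h y < 1" using h_bot by (rule order_tendstoD) simp
    moreover have "\<forall>\<^sub>F y in at_bot. y \<le> x + 1 / F x" by (rule eventually_le_at_bot)
    ultimately have "\<forall>\<^sub>F y in at_bot. h y < 1 \<and> y \<le> x + 1 / F x" by (rule eventually_conj)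
    then obtain y where y: "h y < 1" "y \<le> x + 1 / F x"
      using eventually_happens'[of "at_bot :: real filter"] by auto
    then have "F x * (1 / F x) \<le> F x * (y - x)"
      using neg by (intro mult_left_mono_neg) auto
    then show False using y tangent[of x y] nonneg[of x] neg by simp
  qed
  have F_bot: "(F \<longlongrightarrow> 0) at_bot"
  proof (rule tendsto_sandwich[of "\<lambda>_. 0" F at_bot "\<lambda>x. h (x + 1)"])
    have "F x \<le> h (x + 1)" for x using tangent[of x "x + 1"] nonneg[of x] by simp
    then show "\<forall>\<^sub>F x in at_bot. F x \<le> h (x + 1)" by simp
    have "filterlim (\<lambda>x::real. x + 1) at_bot at_bot"
      by (subst filterlim_at_bot)
        (auto simp: eventually_at_bot_linorder le_diff_eq[symmetric])
    then show "((\<lambda>x. h (x + 1)) \<longlongrightarrow> 0) at_bot" by (rule filterlim_compose[OF h_bot])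
  qed (use F_nonneg in auto)
  have F_bounded: "F x \<le> measure M (space M)" for x
  proof (rule ccontr)
    define e where "e = F x - measure M (space M)"
    assume "\<not> F x \<le> measure M (space M)"
    then have e: "0 < e" by (simp add: e_def)
    \<comment> \<open>At this distance a slope exceeding the total mass by \<open>e\<close> would lift \<open>h\<close> above \<open>P\<^sub>M\<close>.\<close>
    define y where "y = x + (put_fn M x + 1) / e"
    have yx: "0 < y - x" using e put_fn_nonneg[of M x] by (simp add: y_def)
    have "F x * (y - x) \<le> put_fn M y" using tangent[of x y] nonneg[of x] le[of y] by simp
    also have "\<dots> \<le> put_fn M x + cdf M y * (y - x)"
      using put_fn_secant_bounds(2)[OF M, of x y] yx by simp
    also have "\<dots> \<le> put_fn M x + measure M (space M) * (y - x)"
      using M.cdf_bounded yx by (simp add: mult_right_mono)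
    finally have "e * (y - x) \<le> put_fn M x" by (simp add: e_def algebra_simps)
    then show False using e by (simp add: y_def)
  qed
  have F_bdd: "bdd_above (range F)" by (rule bdd_aboveI2) (rule F_bounded)
  have F_top: "(F \<longlongrightarrow> (SUP x. F x)) at_top"
  proof (rule order_tendstoI)
    fix c assume "c < (SUP x. F x)"
    then obtain x where "c < F x" by (auto simp: less_cSUP_iff[OF _ F_bdd])
    then show "\<forall>\<^sub>F x in at_top. c < F x"
      using F_mono by (intro eventually_at_top_linorderI[of x]) (auto intro: less_le_trans)
  next
    fix c assume "(SUP x. F x) < c"
    then show "\<forall>\<^sub>F x in at_top. F x < c"
      using cSUP_upper[OF _ F_bdd] by (intro always_eventually allI) (auto intro: le_less_trans)
  qed
  have F_cont: "continuous (at_right a) F" for a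
    unfolding F_def by (rule right_slope_right_continuous[OF h])
  define S where "S = interval_measure F"
  have "0 \<le> (SUP x. F x)" using cSUP_upper[OF UNIV_I F_bdd, of 0] F_nonneg[of 0] by simp
  then have S: "finite_borel_measure S"
    unfolding S_def
    by (intro finite_borel_measure_interval_measure[OF F_mono F_cont F_bot F_top])
  have cdf_S: "cdf S = F"
    unfolding S_def by (rule cdf_interval_measure[OF F_mono F_cont F_bot])
  note S_borel[measurable_cong] = finite_borel_measure.M_is_borel[OF S]
  have put_int: "integrable S (\<lambda>x. max (v - x) 0 - max (u - x) 0)" for u v
  proof (cases "u \<le> v")
    case False
    then have "integrable S (\<lambda>x. - (max (u - x) 0 - max (v - x) 0))"
      by (intro integrable_minus put_difference_bounds[OF S]) simp
    then show ?thesis by simp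
  qed (rule put_difference_bounds[OF S])
  define G where "G v = (\<integral>x. max (v - x) 0 - max (0 - x) 0 \<partial>S)" for v
  have G: "G v - G u = (\<integral>x. max (v - x) 0 - max (u - x) 0 \<partial>S)" for u v
    unfolding G_def Bochner_Integration.integral_diff[OF put_int put_int, symmetric] by simp
  have incr: "(\<integral>x. max (v - x) 0 - max (u - x) 0 \<partial>S) = h v - h u" if "u \<le> v" for u v
    unfolding G[symmetric]
  proof (rule secant_bounds_increment_unique[of F G h, OF _ _ _ _ that])
    fix u v :: real assume uv: "u \<le> v"
    show "F u * (v - u) \<le> G v - G u" "G v - G u \<le> F v * (v - u)"
      using put_difference_bounds(2,3)[OF S uv] by (simp_all add: G cdf_S)
    show "F u * (v - u) \<le> h v - h u" "h v - h u \<le> F v * (v - u)"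
      using tangent[of u v] tangent[of v u] by (simp_all add: algebra_simps)
  qed
  have put_S: "integrable S (\<lambda>x. max (v - x) 0) \<and> (\<integral>x. max (v - x) 0 \<partial>S) = h v" for v
  proof -
    \<comment> \<open>Truncated payoffs have known integrals \<open>h v - h (v - n)\<close> and increase to the put payoff.\<close>
    define f where "f n x = max (v - x) 0 - max (v - real n - x) 0" for n x
    have lim: "(\<lambda>n. \<integral>x. f n x \<partial>S) \<longlonglongrightarrow> h v"
    proof -
      have "filterlim (\<lambda>n. v - real n) at_bot sequentially"
        unfolding filterlim_at_bot
      proof
        fix Z
        have "\<forall>\<^sub>F n in sequentially. v - Z \<le> real n"
          using filterlim_real_sequentially unfolding filterlim_at_top by blast
        then show "\<forall>\<^sub>F n in sequentially. v - real n \<le> Z" by eventually_elim simp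
      qed
      then have "(\<lambda>n. h (v - real n)) \<longlonglongrightarrow> 0" by (rule filterlim_compose[OF h_bot])
      from tendsto_diff[OF tendsto_const[of "h v"] this]
      show ?thesis by (simp add: f_def incr)
    qed
    have int: "integrable S (f n)" for n unfolding f_def by (rule put_int)
    have mono: "AE x in S. mono (\<lambda>n. f n x)" by (auto simp: f_def mono_def)
    have "(\<lambda>n. f n x) \<longlonglongrightarrow> max (v - x) 0" for x
    proof (rule tendsto_eventually)
      obtain N where "v - x \<le> real N" using real_arch_simple by blast
      then show "\<forall>\<^sub>F n in sequentially. f n x = max (v - x) 0"
        by (intro eventually_sequentiallyI[of N]) (simp add: f_def)
    qed
    then have conv: "AE x in S. (\<lambda>n. f n x) \<longlonglongrightarrow> max (v - x) 0" by simp
    have meas: "(\<lambda>x. max (v - x) 0) \<in> borel_measurable S" by measurable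
    show ?thesis
      using integrable_monotone_convergence[OF int mono conv lim meas]
        integral_monotone_convergence[OF int mono conv lim meas] by simp
  qed
  show ?thesis
    by (rule that[of S]) (use S put_S in \<open>auto simp: put_integrable_def put_fn_def\<close>)
qed

lemma finite_borel_measure_plus:
  assumes M: "finite_borel_measure M" and N: "finite_borel_measure N"
  obtains R where "finite_borel_measure R"
    "\<And>A. A \<in> sets borel \<Longrightarrow> emeasure R A = emeasure M A + emeasure N A"
proof -
  interpret M: finite_borel_measure M by fact
  interpret N: finite_borel_measure N by fact
  define R :: "real measure" where
    "R = measure_of UNIV (sets borel) (\<lambda>A. emeasure M A + emeasure N A)"
  have sets_R: "sets R = sets borel"
    by (simp add: R_def sets.sigma_sets_eq[of borel, simplified])
  have R: "emeasure R A = emeasure M A + emeasure N A" if "A \<in> sets borel" for A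
  proof (rule emeasure_measure_of[OF R_def])
    show "countably_additive (sets R) (\<lambda>A. emeasure M A + emeasure N A)"
    proof (rule countably_additiveI)
      fix A :: "nat \<Rightarrow> real set"
      assume A: "range A \<subseteq> sets R" "disjoint_family A"
      then have "(\<Sum>i. emeasure M (A i) + emeasure N (A i)) =
          (\<Sum>i. emeasure M (A i)) + (\<Sum>i. emeasure N (A i))"
        by (intro suminf_add[symmetric]) auto
      also have "\<dots> = emeasure M (\<Union>i. A i) + emeasure N (\<Union>i. A i)"
        using A by (intro arg_cong2[where f = "(+)"] suminf_emeasure)
          (auto simp: sets_R M.M_is_borel N.M_is_borel)
      finally show "(\<Sum>i. emeasure M (A i) + emeasure N (A i)) =
          emeasure M (\<Union> (range A)) + emeasure N (\<Union> (range A))" .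
    qed
  qed (use that in \<open>auto simp: positive_def sets_R\<close>)
  have "finite_measure R"
    using sets_eq_imp_space_eq[OF sets_R] M.emeasure_finite N.emeasure_finite
    by (intro finite_measureI) (simp add: R)
  then have "finite_borel_measure R"
    using sets_R by (simp add: finite_borel_measure_def finite_borel_measure_axioms_def)
  then show ?thesis using R by (rule that)
qed

text \<open>The sum of the distribution functions of \<open>M\<close> and \<open>N\<close> satisfies the secant bounds of the put function
  of \<open>R\<close>, so it is the distribution function of \<open>R\<close>. Thus \<open>R = M + N\<close>.\<close>

lemma le_of_put_fn_add:
  assumes M: "put_integrable M" and N: "put_integrable N" and R: "put_integrable R"
    and add: "\<And>k. put_fn R k = put_fn M k + put_fn N k"
  shows "M \<le> R"
proof -
  have fin: "finite_borel_measure M" "finite_borel_measure N" "finite_borel_measure R"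
    using assms by (auto simp: put_integrable_def)
  obtain Q where Q: "finite_borel_measure Q"
    and Q_eq: "\<And>A. A \<in> sets borel \<Longrightarrow> emeasure Q A = emeasure M A + emeasure N A"
    using finite_borel_measure_plus[OF fin(1,2)] by blast
  have cdf_Q: "cdf Q = (\<lambda>x. cdf M x + cdf N x)"
    using fin Q_eq by (auto simp: cdf_def measure_def enn2real_plus less_top[symmetric]
      finite_borel_measure_def finite_measure.emeasure_finite intro!: ext)
  have "cdf Q = cdf R"
  proof (rule right_continuous_secant_bounds_unique[where P = "put_fn R"])
    fix u v :: real assume "u < v"
    then show "cdf Q u * (v - u) \<le> put_fn R v - put_fn R u"
      "put_fn R v - put_fn R u \<le> cdf Q v * (v - u)"
      using put_fn_secant_bounds[OF M, of u v] put_fn_secant_bounds[OF N, of u v]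
      by (simp_all add: add cdf_Q distrib_right)
  qed (use put_fn_secant_bounds[OF R] Q fin
      in \<open>auto simp: finite_borel_measure.cdf_is_right_cont\<close>)
  then have "R = Q" using cdf_unique'[OF Q fin(3)] by simp
  then show ?thesis
    using Q_eq fin by (subst le_measure) (auto simp: finite_borel_measure.M_is_borel)
qed

section \<open>Masses and means from the asymptotics of put functions\<close>

lemma fin_mean_put_integrable:
  assumes "M \<in> fin_mean_measures"
  shows "put_integrable M"
proof -
  have sets[measurable_cong]: "sets M = sets borel" and fin: "finite_measure M"
    and abs: "integrable M (\<lambda>x. \<bar>x\<bar>)"
    using assms by (auto simp: fin_mean_measures_def)
  interpret finite_measure M by fact
  have "integrable M (\<lambda>x. max (k - x) 0)" for k
    by (rule Bochner_Integration.integrable_bound[where f = "\<lambda>x. \<bar>k\<bar> + \<bar>x\<bar>"])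
      (auto intro!: Bochner_Integration.integrable_add abs)
  then show ?thesis
    using sets fin
    by (simp add: put_integrable_def finite_borel_measure_def finite_borel_measure_axioms_def)
qed

lemma fin_mean_measures_facts:
  assumes "M \<in> fin_mean_measures"
  shows "finite_borel_measure M" "sets M = sets borel" "space M = UNIV"
    "integrable M (\<lambda>x. x)" "\<And>c::real. integrable M (\<lambda>x. c)" "\<And>k. integrable M (\<lambda>x. max (k - x) 0)"
proof -
  show fb: "finite_borel_measure M" and "\<And>k. integrable M (\<lambda>x. max (k - x) 0)"
    using fin_mean_put_integrable[OF assms] by (auto simp: put_integrable_def)
  interpret finite_borel_measure M by fact
  show sets: "sets M = sets borel" and "space M = UNIV"
    by (auto simp: M_is_borel borel_UNIV)
  show "integrable M (\<lambda>x. x)"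
    using assms by (subst integrable_abs_iff[symmetric])
      (auto simp: fin_mean_measures_def sets cong: measurable_cong_sets)
  show "integrable M (\<lambda>x. c)" for c :: real by simp
qed

text \<open>Put-call parity: the put function differs from its asymptote at \<open>+\<infinity>\<close>, whose slope is the mass and
  whose intercept is minus the first moment, by the integrated call payoff.\<close>

lemma put_fn_eq_line:
  assumes "M \<in> fin_mean_measures"
  shows "integrable M (\<lambda>x. max (x - k) 0)"
    and "put_fn M k = k * measure M UNIV - (\<integral>x. x \<partial>M) + (\<integral>x. max (x - k) 0 \<partial>M)"
proof -
  note M = fin_mean_measures_facts[OF assms]
  have eq: "max (x - k) 0 = max (k - x) 0 - (k - x)" for x by (simp add: max_def)
  show "integrable M (\<lambda>x. max (x - k) 0)"
    unfolding eq by (intro Bochner_Integration.integrable_diff M)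
  have "(\<integral>x. max (x - k) 0 \<partial>M) = put_fn M k - ((\<integral>x. k \<partial>M) - (\<integral>x. x \<partial>M))"
    unfolding eq put_fn_def
    by (subst Bochner_Integration.integral_diff; (intro Bochner_Integration.integrable_diff M)?)+ simp
  then show "put_fn M k = k * measure M UNIV - (\<integral>x. x \<partial>M) + (\<integral>x. max (x - k) 0 \<partial>M)"
    by (simp add: M)
qed

lemma put_fn_ge_line:
  assumes "M \<in> fin_mean_measures"
  shows "k * measure M UNIV - (\<integral>x. x \<partial>M) \<le> put_fn M k"
proof -
  have "0 \<le> (\<integral>x. max (x - k) 0 \<partial>M)" by (rule integral_nonneg_AE) simp
  then show ?thesis by (simp add: put_fn_eq_line[OF assms])
qed

lemma put_fn_le_line:
  assumes "M \<in> fin_mean_measures" and "0 \<le> k"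
  shows "put_fn M k \<le> k * measure M UNIV + (\<integral>x. \<bar>x\<bar> \<partial>M)"
proof -
  note M = fin_mean_measures_facts[OF assms(1)]
  have abs: "integrable M (\<lambda>x. \<bar>x\<bar>)" using assms by (simp add: fin_mean_measures_def)
  have "put_fn M k \<le> (\<integral>x. k + \<bar>x\<bar> \<partial>M)"
    unfolding put_fn_def using assms(2)
    by (intro integral_mono Bochner_Integration.integrable_add M abs) auto
  also have "\<dots> = k * measure M UNIV + (\<integral>x. \<bar>x\<bar> \<partial>M)"
    using M(5) abs by (simp add: M)
  finally show ?thesis .
qed

lemma call_at_top:
  assumes "M \<in> fin_mean_measures"
  shows "((\<lambda>k. \<integral>x. max (x - k) 0 \<partial>M) \<longlongrightarrow> 0) at_top"
proof -
  note M = fin_mean_measures_facts[OF assms]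
  note M(2)[measurable_cong]
  have "((\<lambda>k. \<integral>x. max (x - k) 0 \<partial>M) \<longlongrightarrow> (\<integral>x. 0 \<partial>M)) at_top"
  proof (rule integral_dominated_convergence_at_top)
    show "integrable M (\<lambda>x. max (x - 0) 0)" by (rule put_fn_eq_line[OF assms])
    show "\<forall>\<^sub>F k in at_top. AE x in M. norm (max (x - k) 0) \<le> max (x - 0) 0"
      using eventually_ge_at_top[of 0] by eventually_elim auto
    have "((\<lambda>k. max (x - k) 0) \<longlongrightarrow> 0) at_top" for x :: real
      by (rule tendsto_eventually)
        (use eventually_ge_at_top[of x] in \<open>eventually_elim, auto\<close>)
    then show "AE x in M. ((\<lambda>k. max (x - k) 0) \<longlongrightarrow> 0) at_top" by simp
  qed auto
  then show ?thesis by simp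
qed

text \<open>For equal masses the asymptotes at \<open>+\<infinity>\<close> are parallel, and the larger put function has the higher
  one.\<close>

lemma mean_antimono_put_fn:
  assumes M: "M \<in> fin_mean_measures" and N: "N \<in> fin_mean_measures"
    and mass: "measure M UNIV = measure N UNIV" and le: "\<And>k. put_fn M k \<le> put_fn N k"
  shows "(\<integral>x. x \<partial>N) \<le> (\<integral>x. x \<partial>M)"
proof (rule tendsto_lowerbound)
  show "((\<lambda>k. (\<integral>x. x \<partial>M) + (\<integral>x. max (x - k) 0 \<partial>N)) \<longlongrightarrow> (\<integral>x. x \<partial>M)) at_top"
    using tendsto_add[OF tendsto_const call_at_top[OF N]] by simp
  have "(\<integral>x. x \<partial>N) \<le> (\<integral>x. x \<partial>M) + (\<integral>x. max (x - k) 0 \<partial>N)" for k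
    using put_fn_ge_line[OF M, of k] put_fn_eq_line(2)[OF N, of k] le[of k] mass by simp
  then show "\<forall>\<^sub>F k in at_top. (\<integral>x. x \<partial>N) \<le> (\<integral>x. x \<partial>M) + (\<integral>x. max (x - k) 0 \<partial>N)"
    by simp
qed simp

section \<open>From put functions to the convex decreasing order\<close>

text \<open>For functions with an integrable minorant, the extended integral is the Bochner integral or
  \<open>\<infinity>\<close>, according to integrability.\<close>

lemma ext_integral_integrable:
  "integrable M f \<Longrightarrow> ext_integral M f = ereal (\<integral>x. f x \<partial>M)"
proof -
  assume f: "integrable M f"
  obtain a where a: "0 \<le> a" "(\<integral>\<^sup>+x. ennreal (f x) \<partial>M) = ennreal a"
    using f by (cases "\<integral>\<^sup>+x. ennreal (f x) \<partial>M") (auto simp: real_integrable_def)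
  obtain b where b: "0 \<le> b" "(\<integral>\<^sup>+x. ennreal (- f x) \<partial>M) = ennreal b"
    using f by (cases "\<integral>\<^sup>+x. ennreal (- f x) \<partial>M") (auto simp: real_integrable_def)
  show ?thesis
    using real_lebesgue_integral_def[OF f] a b by (simp add: ext_integral_def)
qed

lemma ext_integral_eq_infinity:
  assumes "f \<in> borel_measurable M" "\<not> integrable M f" and "integrable M l" "\<And>x. l x \<le> f x"
  shows "ext_integral M f = \<infinity>"
proof -
  have "(\<integral>\<^sup>+x. ennreal (- f x) \<partial>M) \<le> (\<integral>\<^sup>+x. ennreal (- l x) \<partial>M)"
    by (intro nn_integral_mono ennreal_leI) (simp add: assms(4))
  also have "\<dots> < \<infinity>" using assms(3) by (simp add: real_integrable_def less_top)
  finally have neg: "(\<integral>\<^sup>+x. ennreal (- f x) \<partial>M) < \<infinity>" .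
  then obtain b where "0 \<le> b" "(\<integral>\<^sup>+x. ennreal (- f x) \<partial>M) = ennreal b"
    by (cases "\<integral>\<^sup>+x. ennreal (- f x) \<partial>M") auto
  moreover have "(\<integral>\<^sup>+x. ennreal (f x) \<partial>M) = \<infinity>"
    using assms(1,2) neg by (auto simp: real_integrable_def)
  ultimately show ?thesis by (simp add: ext_integral_def)
qed

definition tangent :: "(real \<Rightarrow> real) \<Rightarrow> real \<Rightarrow> real \<Rightarrow> real" where
  "tangent f a x = f a + right_slope f a * (x - a)"

text \<open>For decreasing points \<open>y\<close> and convex \<open>f\<close> this is the maximum of the tangents at \<open>y 0, \<dots>, y n\<close>.
  Written as a sum, it is visibly an affine function plus non-negative multiples of put payoffs:
  a tangent further to the left is steeper downwards, so the positive part of its difference to the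
  previous tangent is a multiple of a put payoff.\<close>

primrec tangent_envelope :: "(real \<Rightarrow> real) \<Rightarrow> (nat \<Rightarrow> real) \<Rightarrow> nat \<Rightarrow> real \<Rightarrow> real" where
  "tangent_envelope f y 0 = tangent f (y 0)"
| "tangent_envelope f y (Suc j) =
    (\<lambda>x. tangent_envelope f y j x + max (tangent f (y (Suc j)) x - tangent f (y j) x) 0)"

lemma tangent_le: "convex_on UNIV f \<Longrightarrow> tangent f a x \<le> f x"
  unfolding tangent_def by (rule right_slope_subgradient)

lemma tangent_diff_antimono:
  assumes "convex_on UNIV f" "a \<le> b" "x \<le> z"
  shows "tangent f a z - tangent f b z \<le> tangent f a x - tangent f b x"
proof -
  have "(right_slope f a - right_slope f b) * (z - x) \<le> 0"
    using right_slope_mono[OF assms(1,2)] assms(3) by (simp add: mult_nonpos_nonneg)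
  then show ?thesis by (simp add: tangent_def algebra_simps)
qed

text \<open>Consecutive tangents at \<open>a \<le> b\<close> cross between \<open>a\<close> and \<open>b\<close>. To the left of \<open>b\<close> the envelope of the
  earlier points is the tangent at \<open>b\<close>, so that adding the positive part replaces it by a maximum of
  two tangents; to the right of \<open>b\<close> nothing is added. The second conjunct feeds this induction.\<close>

lemma tangent_envelope_bounds:
  assumes f: "convex_on UNIV f" and y: "antimono y"
  shows "tangent_envelope f y n x \<le> f x \<and> (x \<le> y n \<longrightarrow> tangent_envelope f y n x = tangent f (y n) x)"
proof (induction n)
  case 0
  then show ?case by (simp add: tangent_le[OF f])
next
  case (Suc n)
  let ?a = "y (Suc n)" and ?b = "y n"
  have ab: "?a \<le> ?b" using y by (simp add: antimonoD)
  note diff = tangent_diff_antimono[OF f ab]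
  have at_a: "tangent f ?b ?a \<le> tangent f ?a ?a" and at_b: "tangent f ?a ?b \<le> tangent f ?b ?b"
    using tangent_le[OF f] by (auto simp: tangent_def[of _ "?a" "?a"] tangent_def[of _ "?b" "?b"])
  show ?case
  proof (cases "x \<le> ?b")
    case True
    then have "tangent_envelope f y (Suc n) x = max (tangent f ?a x) (tangent f ?b x)"
      using Suc by simp
    moreover have "tangent f ?b x \<le> tangent f ?a x" if "x \<le> ?a"
      using diff[OF that] at_a by simp
    ultimately show ?thesis
      using tangent_le[OF f] by (simp del: tangent_envelope.simps add: max_absorb1)
  next
    case False
    then have "tangent f ?a x \<le> tangent f ?b x" using diff[of ?b x] at_b by simp
    then show ?thesis using Suc ab False by simp
  qed
qed

lemma tangent_envelope_mono: "i \<le> n \<Longrightarrow> tangent_envelope f y i x \<le> tangent_envelope f y n x"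
  by (induction rule: dec_induct) auto

lemma tangent_le_envelope:
  assumes "i \<le> n"
  shows "tangent f (y i) x \<le> tangent_envelope f y n x"
proof -
  have "tangent f (y i) x \<le> tangent_envelope f y i x" by (induction i) auto
  then show ?thesis using tangent_envelope_mono[OF assms] by (rule order_trans)
qed

text \<open>If the slopes agree, the tangent at \<open>a\<close> is nowhere above the one at \<open>b\<close>, since it is not above
  \<open>f\<close> at \<open>b\<close>, and \<open>c = 0\<close> works. Otherwise \<open>k\<close> is the point where they cross.\<close>

lemma tangent_diff_put:
  assumes f: "convex_on UNIV f" and "a \<le> b"
  obtains c k where "0 \<le> c" "\<And>x. max (tangent f a x - tangent f b x) 0 = c * max (k - x) 0"
proof -
  define c where "c = right_slope f b - right_slope f a"
  have c: "0 \<le> c" using right_slope_mono[OF f \<open>a \<le> b\<close>] by (simp add: c_def)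
  have diff: "tangent f a x - tangent f b x = tangent f a b - f b + c * (b - x)" for x
    by (simp add: tangent_def c_def algebra_simps)
  show ?thesis
  proof (cases "c = 0")
    case True
    then have "max (tangent f a x - tangent f b x) 0 = 0 * max (0 - x) 0" for x
      using diff[of x] tangent_le[OF f, of a b] by simp
    then show ?thesis by (rule that[rotated]) simp
  next
    case False
    define k where "k = b + (tangent f a b - f b) / c"
    have "tangent f a x - tangent f b x = c * (k - x)" for x
      unfolding diff k_def using False by (simp add: field_simps)
    then have "max (tangent f a x - tangent f b x) 0 = c * max (k - x) 0" for x
      using c by (simp add: max_mult_distrib_left)
    then show ?thesis by (rule that[OF c])
  qed
qed

lemma tangent_envelope_integral_mono:
  assumes M: "M \<in> fin_mean_measures" and N: "N \<in> fin_mean_measures"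
    and mass: "measure M UNIV = measure N UNIV" and le: "\<And>k. put_fn M k \<le> put_fn N k"
    and f: "convex_on UNIV f" "antimono f" and y: "antimono y"
  shows "integrable M (tangent_envelope f y n) \<and> integrable N (tangent_envelope f y n) \<and>
    (\<integral>x. tangent_envelope f y n x \<partial>M) \<le> (\<integral>x. tangent_envelope f y n x \<partial>N)"
proof (induction n)
  case 0
  define s where "s = right_slope f (y 0)"
  have "f (y 0) + s * (y 0 + 1 - y 0) \<le> f (y 0 + 1)"
    unfolding s_def by (rule right_slope_subgradient[OF f(1)])
  moreover have "f (y 0 + 1) \<le> f (y 0)" using f(2) by (simp add: antimonoD)
  ultimately have s: "s \<le> 0" by simp
  have eq: "tangent_envelope f y 0 = (\<lambda>x. (f (y 0) - s * y 0) + s * x)"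
    by (auto simp: tangent_def s_def algebra_simps)
  have "integrable K (tangent_envelope f y 0)"
    "(\<integral>x. tangent_envelope f y 0 x \<partial>K) = (f (y 0) - s * y 0) * measure K UNIV + s * (\<integral>x. x \<partial>K)"
    if "K \<in> fin_mean_measures" for K
    unfolding eq using fin_mean_measures_facts[OF that] by simp_all
  then show ?case
    using M N mass s mean_antimono_put_fn[OF M N mass le] by (simp add: mult_left_mono_neg)
next
  case (Suc n)
  obtain c k where c: "0 \<le> c"
    and "\<And>x. max (tangent f (y (Suc n)) x - tangent f (y n) x) 0 = c * max (k - x) 0"
    using tangent_diff_put[OF f(1), of "y (Suc n)" "y n"] y by (auto simp: antimonoD)
  then have "tangent_envelope f y (Suc n) = (\<lambda>x. tangent_envelope f y n x + c * max (k - x) 0)"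
    by simp
  moreover have "c * (\<integral>x. max (k - x) 0 \<partial>M) \<le> c * (\<integral>x. max (k - x) 0 \<partial>N)"
    using le[of k] c by (intro mult_left_mono) (simp_all add: put_fn_def)
  ultimately show ?case
    using Suc fin_mean_measures_facts(6)[OF M, of k] fin_mean_measures_facts(6)[OF N, of k]
    by simp
qed

text \<open>Tangent envelopes approximate \<open>f\<close> from below, and the inequality holds for each of them. Fatou's
  lemma transfers it to \<open>f\<close>; the common minorant it requires is the tangent at \<open>0\<close>, and for this
  reason \<open>0\<close> is a point of every grid.\<close>

lemma cd_le_of_put_fn_le:
  assumes M: "M \<in> fin_mean_measures" and N: "N \<in> fin_mean_measures"
    and mass: "measure M UNIV = measure N UNIV" and le: "\<And>k. put_fn M k \<le> put_fn N k"
  shows "M \<le>\<^sub>c\<^sub>d N"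
  unfolding cd_le_def
proof (intro allI impI, elim conjE)
  fix f :: "real \<Rightarrow> real" assume f: "convex_on UNIV f" "antimono f"
  \<comment> \<open>The \<open>n\<close>-th grid runs downwards from \<open>n\<close> to \<open>- n\<close> with mesh \<open>1 / (n + 1)\<close>.\<close>
  define y where "y n i = real n - real i / real (n + 1)" for n i :: nat
  define p where "p n = tangent_envelope f (y n) (2 * n * (n + 1))" for n
  have y: "antimono (y n)" for n by (auto simp: y_def antimono_def divide_right_mono)
  note M_facts = fin_mean_measures_facts[OF M] and N_facts = fin_mean_measures_facts[OF N]
  note M_facts(2)[measurable_cong] N_facts(2)[measurable_cong]
  have f_meas[measurable]: "f \<in> borel_measurable borel"
    by (rule borel_measurable_continuous_onI[OF convex_on_UNIV_continuous[OF f(1)]])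
  have p_le: "p n x \<le> f x" for n x
    using tangent_envelope_bounds[OF f(1) y] by (simp add: p_def)
  have p: "integrable M (p n)" "integrable N (p n)" "(\<integral>x. p n x \<partial>M) \<le> (\<integral>x. p n x \<partial>N)" for n
    using tangent_envelope_integral_mono[OF M N mass le f y] by (simp_all add: p_def)
  define l where "l = tangent f 0"
  have l_le: "l x \<le> p n x" for n x
  proof -
    have "y n (n * (n + 1)) = 0" 
      unfolding y_def of_nat_mult by (subst nonzero_mult_div_cancel_right) simp_all
    then show ?thesis
      using tangent_le_envelope[of "n * (n + 1)" "2 * n * (n + 1)" f "y n" x]
      by (simp add: p_def l_def)
  qed
  have l_int: "integrable K l" if "K \<in> fin_mean_measures" for K
    using fin_mean_measures_facts[OF that] unfolding l_def tangent_def by simp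
  have p_lim: "(\<lambda>n. p n x) \<longlonglongrightarrow> f x" for x
  proof (rule tendsto_sandwich)
    define C where "C = right_slope f x - right_slope f (x - 1)"
    obtain n0 where n0: "\<bar>x\<bar> + 1 \<le> real n0" using real_arch_simple by blast
    have "f x - C / real (n + 1) \<le> p n x" if "n0 \<le> n" for n
    proof -
      \<comment> \<open>The index of the grid point next to \<open>x\<close> on its left.\<close>
      define i where "i = nat \<lceil>(real n - x) * real (n + 1)\<rceil>"
      have n: "\<bar>x\<bar> + 1 \<le> real n" using n0 that by simp
      then have "0 \<le> (real n - x) * real (n + 1)" by simp
      then have i: "(real n - x) * real (n + 1) \<le> real i" "real i \<le> (real n - x) * real (n + 1) + 1"
        unfolding i_def by linarith+
      have pos: "0 < real (n + 1)" by simp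
      have "real n - x \<le> real i / real (n + 1)"
        using i(1) by (simp only: pos_le_divide_eq[OF pos])
      then have a: "y n i \<le> x" by (simp add: y_def)
      have "real i / real (n + 1) - 1 / real (n + 1) \<le> real n - x"
        using i(2) unfolding diff_divide_distrib[symmetric] pos_divide_le_eq[OF pos] by linarith
      then have xa: "x - y n i \<le> 1 / real (n + 1)" by (simp add: y_def)
      have "(real n - x) * real (n + 1) + 1 \<le> (2 * real n - 1) * real (n + 1) + 1"
        using n by (intro add_right_mono mult_right_mono) auto
      also have "\<dots> \<le> real (2 * n * (n + 1))" by (simp add: algebra_simps)
      finally have "real i \<le> real (2 * n * (n + 1))" using i(2) by linarith
      then have "i \<le> 2 * n * (n + 1)" by (simp only: of_nat_le_iff)
      then have "tangent f (y n i) x \<le> p n x" unfolding p_def by (rule tangent_le_envelope)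
      moreover have "f x - tangent f (y n i) x \<le> C / real (n + 1)"
      proof -
        have "1 / real (n + 1) \<le> 1" by simp
        then have "x - 1 \<le> y n i" using xa by linarith
        from right_slope_mono[OF f(1) this]
        have "f x - tangent f (y n i) x \<le> C * (x - y n i)"
          using right_slope_subgradient[OF f(1), of x "y n i"]
            mult_right_mono[of "right_slope f (x - 1)" "right_slope f (y n i)" "x - y n i"] a
          by (simp add: C_def tangent_def algebra_simps)
        also have "\<dots> \<le> C * (1 / real (n + 1))"
          using xa right_slope_mono[OF f(1), of "x - 1" x]
          by (intro mult_left_mono) (simp_all add: C_def)
        finally show ?thesis by simp
      qed
      ultimately show ?thesis by linarith
    qed
    then show "\<forall>\<^sub>F n in sequentially. f x - C / real (n + 1) \<le> p n x"
      by (rule eventually_sequentiallyI)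
    have "(\<lambda>n. C / real (Suc n)) \<longlonglongrightarrow> 0"
      by (rule LIMSEQ_Suc) (rule lim_const_over_n)
    from tendsto_diff[OF tendsto_const[of "f x"] this]
    show "(\<lambda>n. f x - C / real (n + 1)) \<longlonglongrightarrow> f x" by simp
  qed (use p_le in auto)
  have l_f: "l x \<le> f x" for x using l_le p_le by (rule order_trans)
  show "ext_integral M f \<le> ext_integral N f"
  proof (cases "integrable N f")
    case False
    have "f \<in> borel_measurable N" by measurable
    then show ?thesis
      using ext_integral_eq_infinity[OF _ False l_int[OF N] l_f] by simp
  next
    case True
    define B where "B = (\<integral>x. f x \<partial>N)"
    have p_B: "(\<integral>x. p n x \<partial>M) \<le> B" for n
      unfolding B_def by (rule order_trans[OF p(3) integral_mono[OF p(2) True p_le]])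
    have l_M: "integrable M l" and p_l: "integrable M (\<lambda>x. p n x - l x)" for n
      using l_int[OF M] p(1) by auto
    have "(\<integral>\<^sup>+x. ennreal (f x - l x) \<partial>M) = (\<integral>\<^sup>+x. liminf (\<lambda>n. ennreal (p n x - l x)) \<partial>M)"
    proof (rule nn_integral_cong)
      fix x
      have "(\<lambda>n. ennreal (p n x - l x)) \<longlonglongrightarrow> ennreal (f x - l x)"
        by (intro tendsto_ennrealI tendsto_diff p_lim tendsto_const)
      then show "ennreal (f x - l x) = liminf (\<lambda>n. ennreal (p n x - l x))"
        by (intro lim_imp_Liminf[symmetric]) auto
    qed
    also have "\<dots> \<le> liminf (\<lambda>n. \<integral>\<^sup>+x. ennreal (p n x - l x) \<partial>M)"
      using p_l by (intro nn_integral_liminf) (auto dest: borel_measurable_integrable)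
    also have "\<dots> \<le> ennreal (B - (\<integral>x. l x \<partial>M))"
    proof (rule Liminf_le, simp, rule always_eventually, rule allI)
      fix n
      have "(\<integral>\<^sup>+x. ennreal (p n x - l x) \<partial>M) = ennreal (\<integral>x. p n x - l x \<partial>M)"
        using p_l l_le by (intro nn_integral_eq_integral) auto
      also have "\<dots> \<le> ennreal (B - (\<integral>x. l x \<partial>M))"
        using p_B[of n] p(1) l_M by (intro ennreal_leI) simp
      finally show "(\<integral>\<^sup>+x. ennreal (p n x - l x) \<partial>M) \<le> ennreal (B - (\<integral>x. l x \<partial>M))" .
    qed
    finally have bound: "(\<integral>\<^sup>+x. ennreal (f x - l x) \<partial>M) \<le> ennreal (B - (\<integral>x. l x \<partial>M))" .
    have "integrable M (\<lambda>x. f x - l x)"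
    proof (rule integrableI_nonneg)
      show "(\<lambda>x. f x - l x) \<in> borel_measurable M"
        using borel_measurable_integrable[OF l_M] by measurable
      show "(\<integral>\<^sup>+x. ennreal (f x - l x) \<partial>M) < \<infinity>"
        using bound by (rule le_less_trans) simp
    qed (simp add: l_f)
    then have f_M: "integrable M f" and
      "(\<integral>\<^sup>+x. ennreal (f x - l x) \<partial>M) = ennreal (\<integral>x. f x - l x \<partial>M)"
      using Bochner_Integration.integrable_add[OF _ l_M, of "\<lambda>x. f x - l x"] l_f
      by (auto intro: nn_integral_eq_integral)
    moreover have "0 \<le> B - (\<integral>x. l x \<partial>M)"
      using p_B[of 0] integral_mono[OF l_M p(1) l_le, of 0] by linarith
    ultimately have "(\<integral>x. f x - l x \<partial>M) \<le> B - (\<integral>x. l x \<partial>M)"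
      using bound by simp
    then have "(\<integral>x. f x \<partial>M) \<le> B" using f_M l_M by simp
    then show ?thesis
      by (simp add: ext_integral_integrable f_M True B_def)
  qed
qed

section \<open>Consequences of the orders for put functions\<close>

lemma put_payoff_convex: "convex_on UNIV (\<lambda>x::real. max (k - x) 0)"
  by (intro convex_on_UNIV_max; rule convex_on_linorderI; simp add: algebra_simps)

text \<open>The convexity defect of the payoff in the strike. It is non-negative, so its integrals show that put
  functions are convex and that convexity survives in \<open>P\<^sub>N - P\<^sub>M\<close> when \<open>M \<le> N\<close>.\<close>

lemma put_gap:
  assumes "put_integrable M"
  shows "integrable M (\<lambda>z. (1 - t) * max (x - z) 0 + t * max (y - z) 0 - max (w - z) 0)"
    and "(\<integral>z. (1 - t) * max (x - z) 0 + t * max (y - z) 0 - max (w - z) 0 \<partial>M) =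
      (1 - t) * put_fn M x + t * put_fn M y - put_fn M w"
  using assms by (simp_all add: put_integrable_def put_fn_def)

lemma put_gap_nonneg:
  fixes x y z t :: real
  assumes "0 < t" "t < 1"
  shows "0 \<le> (1 - t) * max (x - z) 0 + t * max (y - z) 0 - max ((1 - t) * x + t * y - z) 0"
proof -
  have "(1 - t) * (x - z) + t * (y - z) \<le> (1 - t) * max (x - z) 0 + t * max (y - z) 0"
    "0 \<le> (1 - t) * max (x - z) 0 + t * max (y - z) 0"
    using assms by (auto intro!: add_mono mult_left_mono)
  moreover have "(1 - t) * x + t * y - z = (1 - t) * (x - z) + t * (y - z)"
    by (simp add: algebra_simps)
  ultimately show ?thesis by (simp only: diff_ge_0_iff_ge max.bounded_iff simp_thms)
qed

lemma convex_put_fn: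
  assumes "put_integrable M"
  shows "convex_on UNIV (put_fn M)"
proof (rule convex_on_linorderI)
  fix t x y :: real assume t: "0 < t" "t < 1"
  have "0 \<le> (\<integral>z. (1 - t) * max (x - z) 0 + t * max (y - z) 0 - max ((1 - t) * x + t * y - z) 0 \<partial>M)"
    by (rule integral_nonneg_AE) (rule AE_I2, rule put_gap_nonneg[OF t])
  then show "put_fn M ((1 - t) *\<^sub>R x + t *\<^sub>R y) \<le> (1 - t) * put_fn M x + t * put_fn M y"
    by (simp add: put_gap[OF assms])
qed simp

lemma convex_put_fn_diff:
  assumes M: "put_integrable M" and N: "put_integrable N" and le: "M \<le> N"
  shows "convex_on UNIV (\<lambda>k. put_fn N k - put_fn M k)"
proof (rule convex_on_linorderI)
  fix t x y :: real assume t: "0 < t" "t < 1"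
  define w where "w = (1 - t) * x + t * y"
  define \<phi> where "\<phi> z = (1 - t) * max (x - z) 0 + t * max (y - z) 0 - max (w - z) 0" for z
  have \<phi>: "0 \<le> \<phi> z" for z unfolding \<phi>_def w_def by (rule put_gap_nonneg[OF t])
  have int: "integrable M \<phi>" "integrable N \<phi>"
    unfolding \<phi>_def by (rule put_gap[OF M] put_gap[OF N])+
  have eq: "(\<integral>z. \<phi> z \<partial>M) = (1 - t) * put_fn M x + t * put_fn M y - put_fn M w"
    "(\<integral>z. \<phi> z \<partial>N) = (1 - t) * put_fn N x + t * put_fn N y - put_fn N w"
    unfolding \<phi>_def by (rule put_gap[OF M] put_gap[OF N])+
  have "ennreal (\<integral>z. \<phi> z \<partial>M) = (\<integral>\<^sup>+z. ennreal (\<phi> z) \<partial>M)"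
    using int \<phi> by (intro nn_integral_eq_integral[symmetric]) auto
  also have "\<dots> \<le> (\<integral>\<^sup>+z. ennreal (\<phi> z) \<partial>N)"
    using M N le by (intro nn_integral_mono_measure)
      (auto simp: put_integrable_def finite_borel_measure.M_is_borel)
  also have "\<dots> = ennreal (\<integral>z. \<phi> z \<partial>N)"
    using int \<phi> by (intro nn_integral_eq_integral) auto
  finally have "(\<integral>z. \<phi> z \<partial>M) \<le> (\<integral>z. \<phi> z \<partial>N)"
    using \<phi> by (simp add: integral_nonneg_AE)
  then show "put_fn N ((1 - t) *\<^sub>R x + t *\<^sub>R y) - put_fn M ((1 - t) *\<^sub>R x + t *\<^sub>R y)
      \<le> (1 - t) * (put_fn N x - put_fn M x) + t * (put_fn N y - put_fn M y)"
    unfolding real_scaleR_def w_def[symmetric] eq by (simp add: algebra_simps)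
qed simp

lemma pcd_leD:
  assumes M: "M \<in> fin_mean_measures" and N: "N \<in> fin_mean_measures" and le: "M \<le>\<^sub>p\<^sub>c\<^sub>d N"
  shows "measure M UNIV \<le> measure N UNIV" and "put_fn M k \<le> put_fn N k"
proof -
  note Mf = fin_mean_measures_facts[OF M] and Nf = fin_mean_measures_facts[OF N]
  have "ext_integral M (\<lambda>x. 1) \<le> ext_integral N (\<lambda>x. 1)"
    using le by (simp add: pcd_le_def antimono_def convex_on_const)
  then show "measure M UNIV \<le> measure N UNIV"
    by (simp add: ext_integral_integrable[OF Mf(5)] ext_integral_integrable[OF Nf(5)] Mf(3) Nf(3))
  have "antimono (\<lambda>x. max (k - x) 0)" by (auto simp: antimono_def)
  then have "ext_integral M (\<lambda>x. max (k - x) 0) \<le> ext_integral N (\<lambda>x. max (k - x) 0)"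
    using le put_payoff_convex[of k] by (simp add: pcd_le_def)
  then show "put_fn M k \<le> put_fn N k"
    by (simp add: ext_integral_integrable[OF Mf(6)] ext_integral_integrable[OF Nf(6)] put_fn_def)
qed

lemma cd_le_imp_pcd_le: "M \<le>\<^sub>c\<^sub>d N \<Longrightarrow> M \<le>\<^sub>p\<^sub>c\<^sub>d N"
  by (auto simp: cd_le_def pcd_le_def)

text \<open>Constants of either sign are convex and non-increasing.\<close>

lemma cd_le_mass_eq:
  assumes M: "M \<in> fin_mean_measures" and N: "N \<in> fin_mean_measures" and le: "M \<le>\<^sub>c\<^sub>d N"
  shows "measure M UNIV = measure N UNIV"
proof -
  note Mf = fin_mean_measures_facts[OF M] and Nf = fin_mean_measures_facts[OF N]
  have "ext_integral M (\<lambda>x. - 1) \<le> ext_integral N (\<lambda>x. - 1)"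
    using le by (simp add: cd_le_def antimono_def convex_on_const)
  then have "measure N UNIV \<le> measure M UNIV"
    by (simp add: ext_integral_integrable[OF Mf(5)] ext_integral_integrable[OF Nf(5)] Mf(3) Nf(3))
  then show ?thesis using pcd_leD(1)[OF M N cd_le_imp_pcd_le[OF le]] by simp
qed

lemma fin_mean_measures_mono:
  assumes N: "N \<in> fin_mean_measures" and M: "finite_borel_measure M" and le: "M \<le> N"
  shows "M \<in> fin_mean_measures"
proof -
  interpret finite_borel_measure M by fact
  note Nf = fin_mean_measures_facts[OF N]
  note M_is_borel[measurable_cong]
  have "(\<integral>\<^sup>+x. ennreal \<bar>x\<bar> \<partial>M) \<le> (\<integral>\<^sup>+x. ennreal \<bar>x\<bar> \<partial>N)"
    using le Nf(2) by (intro nn_integral_mono_measure) (auto simp: M_is_borel)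
  also have "\<dots> < \<infinity>"
    using N by (auto simp: fin_mean_measures_def integrable_iff_bounded)
  finally have "integrable M (\<lambda>x. \<bar>x\<bar>)" by (simp add: integrable_iff_bounded)
  then show ?thesis using M_is_borel finite_measure_axioms by (simp add: fin_mean_measures_def)
qed

lemma affine_growth_le:
  fixes a b c d :: real
  assumes "\<And>k. k0 \<le> k \<Longrightarrow> a * k + b \<le> c * k + d"
  shows "a \<le> c"
proof (rule ccontr)
  assume "\<not> a \<le> c"
  then have ac: "0 < a - c" by simp
  define k where "k = max k0 ((d - b + 1) / (a - c))"
  have "(d - b + 1) / (a - c) \<le> k" by (simp add: k_def)
  then have "d - b + 1 \<le> k * (a - c)" by (simp only: pos_divide_le_eq[OF ac])
  moreover have "a * k + b \<le> c * k + d" by (rule assms) (simp add: k_def)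
  ultimately show False by (simp add: algebra_simps)
qed

section \<open>The shadow\<close>

text \<open>This minorant keeps the convex hull of \<open>P\<^sub>N - P\<^sub>M\<close> from growing too slowly: it has the
  asymptotic slope of \<open>P\<^sub>N - P\<^sub>M\<close> itself. If \<open>K\<close> is large, the hinge lies below the line that bounds
  \<open>P\<^sub>N - P\<^sub>M\<close> on the positive half-axis.\<close>

lemma hinge_le_put_fn_diff:
  assumes M: "M \<in> fin_mean_measures" and N: "N \<in> fin_mean_measures" and le: "M \<le>\<^sub>p\<^sub>c\<^sub>d N"
  obtains K where "convex_on UNIV (\<lambda>k. (measure N UNIV - measure M UNIV) * max (k - K) 0)"
    and "(\<lambda>k. (measure N UNIV - measure M UNIV) * max (k - K) 0) \<le> (\<lambda>k. put_fn N k - put_fn M k)"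
    and "0 \<le> K"
proof -
  define a where "a = measure N UNIV - measure M UNIV"
  have a: "0 \<le> a" using pcd_leD(1)[OF M N le] by (simp add: a_def)
  define C where "C = (\<integral>x. x \<partial>N) + (\<integral>x. \<bar>x\<bar> \<partial>M)"
  \<comment> \<open>This gives \<open>C \<le> a K\<close> for \<open>a > 0\<close>; division by zero makes \<open>K = 0\<close> for \<open>a = 0\<close>.\<close>
  define K where "K = max 0 (C / a)"
  have "convex_on UNIV (\<lambda>k::real. max (k - K) 0)"
    by (intro convex_on_UNIV_max; rule convex_on_linorderI; simp add: algebra_simps)
  then have "convex_on UNIV (\<lambda>k. a * max (k - K) 0)"
    using a by (intro convex_on_cmul)
  moreover have "a * max (k - K) 0 \<le> put_fn N k - put_fn M k" for k
  proof (cases "a = 0 \<or> k \<le> K")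
    case True
    then show ?thesis using pcd_leD(2)[OF M N le, of k] by auto
  next
    case False
    then have k: "0 \<le> k" and pos: "0 < a" using a by (auto simp: K_def)
    have "C / a \<le> K" by (simp add: K_def)
    then have "C \<le> K * a" by (simp only: pos_divide_le_eq[OF pos])
    then have "a * (k - K) \<le> a * k - C" by (simp add: algebra_simps)
    also have "\<dots> \<le> put_fn N k - put_fn M k"
      using put_fn_ge_line[OF N, of k] put_fn_le_line[OF M k]
      by (simp add: a_def C_def algebra_simps)
    finally show ?thesis using False by simp
  qed
  ultimately show ?thesis
    by (intro that[of K]) (simp_all add: a_def le_fun_def K_def)
qed

lemma shadow_construction:
  assumes \<mu>: "\<mu> \<in> fin_mean_measures" and \<nu>: "\<nu> \<in> fin_mean_measures" and le: "\<mu> \<le>\<^sub>p\<^sub>c\<^sub>d \<nu>"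
  obtains S where "is_shadow \<nu> \<mu> S"
    and "put_fn S = (\<lambda>k. put_fn \<nu> k - convex_hull_fn (\<lambda>x. put_fn \<nu> x - put_fn \<mu> x) k)"
proof -
  define g where "g = convex_hull_fn (\<lambda>x. put_fn \<nu> x - put_fn \<mu> x)"
  define a where "a = measure \<nu> UNIV - measure \<mu> UNIV"
  obtain K where hinge: "convex_on UNIV (\<lambda>k. a * max (k - K) 0)"
    "(\<lambda>k. a * max (k - K) 0) \<le> (\<lambda>k. put_fn \<nu> k - put_fn \<mu> k)" and K: "0 \<le> K"
    using hinge_le_put_fn_diff[OF assms] unfolding a_def by blast
  have a: "0 \<le> a" using pcd_leD(1)[OF assms] by (simp add: a_def)
  note hull = convex_hull_fn_greatest[OF hinge, folded g_def]
  note P\<mu> = fin_mean_put_integrable[OF \<mu>] and P\<nu> = fin_mean_put_integrable[OF \<nu>]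
  have g_lower: "a * max (k - K) 0 \<le> g k" and g_upper: "g k \<le> put_fn \<nu> k - put_fn \<mu> k" for k
    using hull(3)[OF hinge] hull(2) by (auto simp: le_fun_def)
  have g_nonneg: "0 \<le> g k" for k
    by (rule order_trans[OF _ g_lower]) (simp add: a)
  define h where "h k = put_fn \<nu> k - g k" for k
  have h_convex: "convex_on UNIV h"
    unfolding h_def g_def
    by (rule convex_on_diff_convex_hull[OF convex_put_fn[OF P\<nu>] convex_put_fn[OF P\<mu>] hinge])
  have h_ge: "put_fn \<mu> k \<le> h k" for k using g_upper[of k] by (simp add: h_def)
  have h_nonneg: "0 \<le> h k" for k using put_fn_nonneg h_ge by (rule order_trans)
  have h_le: "h k \<le> put_fn \<nu> k" for k using g_nonneg[of k] by (simp add: h_def)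
  obtain S where S: "put_integrable S" "put_fn S = h"
    using put_fn_surj[OF P\<nu> h_convex h_nonneg h_le] by blast
  have g_le: "g k \<le> put_fn \<nu> k" for k
    using g_upper[of k] put_fn_nonneg[of \<mu> k] by simp
  obtain T where T: "put_integrable T" "put_fn T = g"
    using put_fn_surj[OF P\<nu> hull(1) g_nonneg g_le] by blast
  have S_le: "S \<le> \<nu>"
    by (rule le_of_put_fn_add[OF S(1) T(1) P\<nu>]) (simp add: S T h_def)
  have S_fin: "S \<in> fin_mean_measures"
    using fin_mean_measures_mono[OF \<nu> _ S_le] S(1) by (simp add: put_integrable_def)
  \<comment> \<open>Both inequalities compare the growth of put functions at \<open>+\<infinity>\<close>, where the slope is the mass.\<close>
  have mass: "measure \<mu> UNIV = measure S UNIV"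
  proof (rule antisym)
    have "measure \<mu> UNIV * k + (- (\<integral>x. x \<partial>\<mu>)) \<le> measure S UNIV * k + (\<integral>x. \<bar>x\<bar> \<partial>S)" if "0 \<le> k" for k
      using put_fn_ge_line[OF \<mu>, of k] put_fn_le_line[OF S_fin that] h_ge[of k]
      by (simp add: S mult.commute)
    then show "measure \<mu> UNIV \<le> measure S UNIV" by (rule affine_growth_le)
    have "measure S UNIV * k + (- (\<integral>x. x \<partial>S)) \<le> measure \<mu> UNIV * k + ((\<integral>x. \<bar>x\<bar> \<partial>\<nu>) + a * K)"
      if "K \<le> k" for k
    proof -
      have "a * (k - K) \<le> g k" using g_lower[of k] that by simp
      then show ?thesis
        using put_fn_ge_line[OF S_fin, of k] put_fn_le_line[OF \<nu>, of k] that K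
        by (simp add: S h_def a_def algebra_simps)
    qed
    then show "measure S UNIV \<le> measure \<mu> UNIV" by (rule affine_growth_le)
  qed
  have S_ge: "\<mu> \<le>\<^sub>c\<^sub>d S"
    by (rule cd_le_of_put_fn_le[OF \<mu> S_fin mass]) (simp add: S h_ge)
  have least: "S \<le>\<^sub>c\<^sub>d \<eta>" if \<eta>: "\<eta> \<in> fin_mean_measures" "\<mu> \<le>\<^sub>c\<^sub>d \<eta>" "\<eta> \<le> \<nu>" for \<eta>
  proof (rule cd_le_of_put_fn_le[OF S_fin \<eta>(1)])
    show "measure S UNIV = measure \<eta> UNIV"
      using cd_le_mass_eq[OF \<mu> \<eta>(1,2)] mass by simp
    have "convex_on UNIV (\<lambda>k. put_fn \<nu> k - put_fn \<eta> k)"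
      by (rule convex_put_fn_diff[OF fin_mean_put_integrable[OF \<eta>(1)] P\<nu> \<eta>(3)])
    moreover have "(\<lambda>k. put_fn \<nu> k - put_fn \<eta> k) \<le> (\<lambda>k. put_fn \<nu> k - put_fn \<mu> k)"
      using pcd_leD(2)[OF \<mu> \<eta>(1) cd_le_imp_pcd_le[OF \<eta>(2)]] by (simp add: le_fun_def)
    ultimately have "(\<lambda>k. put_fn \<nu> k - put_fn \<eta> k) \<le> g" by (rule hull(3))
    then show "put_fn S k \<le> put_fn \<eta> k" for k
      by (simp add: S h_def le_fun_def diff_le_eq add.commute)
  qed
  show ?thesis
    by (rule that[of S]) (use S_fin S_ge S_le least in \<open>auto simp: is_shadow_def S h_def g_def\<close>)
qed

lemma is_shadow_unique:
  assumes S: "is_shadow \<nu> \<mu> S" and T: "is_shadow \<nu> \<mu> T"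
  shows "S = T"
proof (rule put_fn_inject)
  have fin: "S \<in> fin_mean_measures" "T \<in> fin_mean_measures" and le: "S \<le>\<^sub>c\<^sub>d T" "T \<le>\<^sub>c\<^sub>d S"
    using S T by (auto simp: is_shadow_def)
  then show "put_integrable S" "put_integrable T" by (auto intro: fin_mean_put_integrable)
  show "put_fn S = put_fn T"
    using pcd_leD(2)[OF fin cd_le_imp_pcd_le[OF le(1)]]
      pcd_leD(2)[OF fin(2,1) cd_le_imp_pcd_le[OF le(2)]]
    by (intro ext antisym)
qed

theorem theorem3p1:
  fixes \<mu> \<nu> :: "real measure"
  assumes "\<mu> \<in> fin_mean_measures" and "\<nu> \<in> fin_mean_measures"
    and "\<mu> \<le>\<^sub>p\<^sub>c\<^sub>d \<nu>"
  shows "(\<exists>!S. is_shadow \<nu> \<mu> S) \<and>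
    (\<forall>k. put_fn (shadow \<nu> \<mu>) k =
       put_fn \<nu> k - convex_hull_fn (\<lambda>x. put_fn \<nu> x - put_fn \<mu> x) k)"
proof -
  obtain S where S: "is_shadow \<nu> \<mu> S"
    and put_S: "put_fn S = (\<lambda>k. put_fn \<nu> k - convex_hull_fn (\<lambda>x. put_fn \<nu> x - put_fn \<mu> x) k)"
    using shadow_construction[OF assms] by blast
  have "\<exists>!S. is_shadow \<nu> \<mu> S" using S is_shadow_unique by blast
  moreover have "shadow \<nu> \<mu> = S"
    unfolding shadow_def using S is_shadow_unique by blast
  ultimately show ?thesis by (simp add: put_S)
qed

end
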